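(* For every integer $n\ge 0$, $$\tilde{F}_n=\sum_{k=0}^n\ \sum_{i=0}^k\sum_{j=0}^k\frac{(-1)^{k+i-j}}{i!}\binom{k}{j}j^n .$$
   Context: For $n\ge 0$ let $[n]=\{1,\dots,n\}$. A partition of $[n]$ into $k$ blocks is written $B_1|B_2|\cdots|B_k$, with non-empty disjoint blocks whose union is $[n]$, listed so that $\min B_1<\min B_2<\cdots<\min B_k$. A deranged partition of $[n]$ is an arrangement $B_{\sigma(1)}|B_{\sigma(2)}|\cdots|B_{\sigma(k)}$ of the blocks of some partition $B_1|\cdots|B_k$ of $[n]$, where $\sigma$ is a permutation of $[k]$ such that $B_{\sigma(i)}\neq B_i$ for all $1\le i\le k$ (i.e. $\sigma$ is a derangement). The deranged Bell number $\tilde{F}_n$ is the total number of deranged partitions of $[n]$ (over all $k$), with $\tilde{F}_0=1$. The convention $0^0=1$ is used. *)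

theory Defs
  imports Complex_Main "HOL-Library.Disjoint_Sets" "HOL-Combinatorics.Permutations"
begin

text \<open>The blocks of a partition of \<open>[n]\<close> listed in order of increasing minima; positions are
  counted from 0. The strict order of the minima makes the list distinct.\<close>

definition ordered_blocks :: "nat \<Rightarrow> nat set list \<Rightarrow> bool" where
  "ordered_blocks n Bs \<longleftrightarrow>
     partition_on {1..n} (set Bs) \<and> sorted_wrt (\<lambda>A B. Min A < Min B) Bs"

definition deranged_partitions :: "nat \<Rightarrow> nat set list set" where
  "deranged_partitions n =
     {permute_list \<sigma> Bs | \<sigma> Bs. ordered_blocks n Bs \<and> \<sigma> permutes {..<length Bs} \<and>
        (\<forall>i<length Bs. Bs ! \<sigma> i \<noteq> Bs ! i)}"

definition deranged_bell :: "nat \<Rightarrow> nat" where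
  "deranged_bell n = card (deranged_partitions n)"

lemma finite_deranged_partitions: "finite (deranged_partitions n)"
proof -
  have "deranged_partitions n \<subseteq> {xs. set xs \<subseteq> Pow {1..n} \<and> distinct xs}"
  proof
    fix xs assume "xs \<in> deranged_partitions n"
    then obtain \<sigma> Bs where xs: "xs = permute_list \<sigma> Bs" and ob: "ordered_blocks n Bs"
      and p: "\<sigma> permutes {..<length Bs}"
      unfolding deranged_partitions_def by blast
    have "distinct Bs"
      using ob unfolding ordered_blocks_def distinct_conv_nth sorted_wrt_iff_nth_less
      by (metis less_irrefl linorder_neqE_nat)
    moreover have "set Bs \<subseteq> Pow {1..n}"
      using ob unfolding ordered_blocks_def partition_on_def by auto
    ultimately show "xs \<in> {xs. set xs \<subseteq> Pow {1..n} \<and> distinct xs}"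
      using xs p by simp
  qed
  moreover have "finite {xs. set xs \<subseteq> Pow {1..n} \<and> distinct xs}"
    by (rule finite_subset_distinct) simp
  ultimately show ?thesis by (rule finite_subset)
qed

lemma deranged_bell_0: "deranged_bell 0 = 1"
proof -
  have "deranged_partitions 0 = {[]}"
    unfolding deranged_partitions_def ordered_blocks_def
    by (auto simp: partition_on_empty permute_list_def intro!: exI[of _ id])
  then show ?thesis by (simp add: deranged_bell_def)
qed

end

theory Submission
  imports Defs "HOL-Combinatorics.Multiset_Permutations"
begin

text \<open>
  Let \<open>p k\<close> be the number of partitions of \<open>[n]\<close> into \<open>k\<close> blocks and \<open>d k\<close> the number of
  derangements of \<open>k\<close> points. The blocks of a partition are pairwise distinct, so moving every
  block of the list to a different place is the same as deranging the positions, and a rearranged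
  list still determines its partition. Hence the deranged Bell number is \<open>\<Sum>k\<le>n. p k * d k\<close>
  (\<open>deranged_bell_eq_sum_ordered_blocks\<close>).

  Both factors come from inversion over the subsets of a finite set: every permutation is a
  derangement of the set of points that it moves (\<open>card_derangements\<close>), and every function is
  a surjection onto its image (\<open>card_surjections\<close>). The first inversion gives
  \<open>d k = k! * (\<Sum>i\<le>k. (-1)^i / i!)\<close>. The second gives \<open>k! * p k\<close>, because a list of \<open>k\<close> disjoint
  blocks covering \<open>[n]\<close> is the list of fibres of a surjection onto \<open>k\<close> positions, and every
  partition into \<open>k\<close> blocks can be listed in \<open>k!\<close> orders
  (\<open>fact_times_card_ordered_blocks\<close>). In the product the factor \<open>k!\<close> of \<open>d k\<close>
  combines with \<open>p k\<close>, which leaves the double sum over \<open>i\<close> and \<open>j\<close>.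
\<close>

section \<open>Derangements and surjections by inversion over subsets\<close>

lemma sum_Pow_card:
  fixes h :: "nat \<Rightarrow> 'b::semiring_1"
  assumes "finite S"
  shows "(\<Sum>T\<in>Pow S. h (card T)) = (\<Sum>k=0..card S. of_nat (card S choose k) * h k)"
proof -
  have "(\<Sum>T\<in>Pow S. h (card T)) =
      (\<Sum>k=0..card S. \<Sum>T\<in>{T \<in> Pow S. card T = k}. h (card T))"
    using assms by (intro sum.group[symmetric]) (auto intro: card_mono)
  also have "\<dots> = (\<Sum>k=0..card S. of_nat (card S choose k) * h k)"
  proof (intro sum.cong refl)
    fix k
    have "card {T \<in> Pow S. card T = k} = card S choose k"
      using n_subsets[OF assms, of k] by simp
    then show "(\<Sum>T\<in>{T \<in> Pow S. card T = k}. h (card T)) = of_nat (card S choose k) * h k"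
      by simp
  qed
  finally show ?thesis .
qed

definition derangements :: "'a set \<Rightarrow> ('a \<Rightarrow> 'a) set" where
  "derangements S = {p. p permutes S \<and> (\<forall>x\<in>S. p x \<noteq> x)}"

lemma finite_derangements: "finite S \<Longrightarrow> finite (derangements S)"
  unfolding derangements_def by (rule finite_subset[OF _ finite_permutations]) auto

text \<open>A permutation of \<open>S\<close> belongs to exactly one of the sets on the right: it is a derangement
  of the set of points that it moves.\<close>

lemma fact_eq_sum_derangements:
  assumes "finite S"
  shows "fact (card S) = (\<Sum>T\<in>Pow S. card (derangements T))"
proof -
  have support: "p permutes {x. p x \<noteq> x}" if "p permutes S" for p
    using that by (metis (mono_tags, lifting) mem_Collect_eq permutes_superset
        Diff_iff)
  have "{p. p permutes S} = (\<Union>T\<in>Pow S. derangements T)"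
  proof (intro set_eqI iffI)
    fix p assume "p \<in> {p. p permutes S}"
    then have p: "p permutes S" by simp
    then have "{x. p x \<noteq> x} \<in> Pow S" by (auto dest: permutes_not_in)
    moreover have "p \<in> derangements {x. p x \<noteq> x}"
      using support[OF p] by (simp add: derangements_def)
    ultimately show "p \<in> (\<Union>T\<in>Pow S. derangements T)" by blast
  next
    fix p assume "p \<in> (\<Union>T\<in>Pow S. derangements T)"
    then show "p \<in> {p. p permutes S}"
      by (auto simp: derangements_def intro: permutes_subset)
  qed
  moreover have "card (\<Union>T\<in>Pow S. derangements T) = (\<Sum>T\<in>Pow S. card (derangements T))"
  proof (rule card_UN_disjoint)
    show "finite (Pow S)" using assms by simp
    show "\<forall>T\<in>Pow S. finite (derangements T)"
      using assms by (auto intro: finite_derangements finite_subset)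
    have "T = {x. p x \<noteq> x}" if "p \<in> derangements T" for p T
      using that by (auto simp: derangements_def permutes_def)
    then show "\<forall>T\<in>Pow S. \<forall>U\<in>Pow S. T \<noteq> U \<longrightarrow> derangements T \<inter> derangements U = {}"
      by blast
  qed
  ultimately show ?thesis using card_permutations[OF refl assms] by simp
qed

lemma card_derangements:
  assumes "finite S"
  shows "real (card (derangements S)) =
    fact (card S) * (\<Sum>i=0..card S. (-1) ^ i / fact i)"
proof -
  let ?k = "card S"
  have "real (card (derangements S)) =
      (\<Sum>T\<in>Pow S. (-1) ^ (card S - card T) * fact (card T))"
  proof (rule inclusion_exclusion_mobius[OF _ assms])
    fix U :: "'a set" assume "finite U"
    from arg_cong[OF fact_eq_sum_derangements[OF this], of real]
    show "(fact (card U) :: real) = (\<Sum>T\<in>Pow U. real (card (derangements T)))"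
      by simp
  qed
  also have "\<dots> = (\<Sum>j=0..?k. real (?k choose j) * ((-1) ^ (?k - j) * fact j))"
    using sum_Pow_card[OF assms, of "\<lambda>j. (-1) ^ (?k - j) * fact j :: real"] by simp
  also have "\<dots> = (\<Sum>i=0..?k. real (?k choose (?k - i)) * ((-1) ^ i * fact (?k - i)))"
    by (rule sum.reindex_bij_witness[of _ "\<lambda>i. ?k - i" "\<lambda>i. ?k - i"]) auto
  also have "\<dots> = (\<Sum>i=0..?k. fact ?k * ((-1) ^ i / fact i))"
    by (intro sum.cong refl) (simp add: binomial_fact)
  finally show ?thesis by (simp add: sum_distrib_left)
qed

text \<open>Functions are taken in the extensional function space, so that there are finitely many.\<close>

definition surjections :: "'a set \<Rightarrow> 'b set \<Rightarrow> ('a \<Rightarrow> 'b) set" where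
  "surjections E S = {f \<in> E \<rightarrow>\<^sub>E S. f ` E = S}"

lemma power_card_eq_sum_surjections:
  assumes "finite E" "finite S"
  shows "card S ^ card E = (\<Sum>T\<in>Pow S. card (surjections E T))"
proof -
  have "(E \<rightarrow>\<^sub>E S) = (\<Union>T\<in>Pow S. surjections E T)"
    by (auto simp: surjections_def PiE_iff extensional_def)
  moreover have "card (\<Union>T\<in>Pow S. surjections E T) = (\<Sum>T\<in>Pow S. card (surjections E T))"
  proof (rule card_UN_disjoint)
    show "finite (Pow S)" using assms by simp
    show "\<forall>T\<in>Pow S. finite (surjections E T)"
      using assms by (auto simp: surjections_def intro!: finite_PiE intro: finite_subset)
    show "\<forall>T\<in>Pow S. \<forall>U\<in>Pow S. T \<noteq> U \<longrightarrow> surjections E T \<inter> surjections E U = {}"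
      by (auto simp: surjections_def)
  qed
  ultimately show ?thesis using card_funcsetE[OF assms(1), of S] by simp
qed

lemma card_surjections:
  fixes S :: "'b set"
  assumes "finite E" "finite S"
  shows "real (card (surjections E S)) =
    (\<Sum>j=0..card S. (-1) ^ (card S - j) * real (card S choose j) * real j ^ card E)"
proof -
  let ?k = "card S"
  have "real (card (surjections E S)) =
      (\<Sum>T\<in>Pow S. (-1) ^ (card S - card T) * real (card T) ^ card E)"
  proof (rule inclusion_exclusion_mobius[OF _ assms(2)])
    fix U :: "'b set" assume "finite U"
    from arg_cong[OF power_card_eq_sum_surjections[OF assms(1) this], of real]
    show "real (card U) ^ card E = (\<Sum>T\<in>Pow U. real (card (surjections E T)))"
      by simp
  qed
  also have "\<dots> = (\<Sum>j=0..?k. real (?k choose j) * ((-1) ^ (?k - j) * real j ^ card E))"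
    using sum_Pow_card[OF assms(2), of "\<lambda>j. (-1) ^ (?k - j) * real j ^ card E"] by simp
  finally show ?thesis by (simp add: mult_ac)
qed


section \<open>Ordered lists of blocks\<close>

text \<open>Sending a surjection to the list of its fibres is a bijection. An inverse sends a point to
  the position of the block that contains it.\<close>

lemma card_block_lists:
  "card {xs. partition_on E (set xs) \<and> distinct xs \<and> length xs = k} =
    card (surjections E {..<k})"
proof -
  define fibres where "fibres f = map (\<lambda>i. {x\<in>E. f x = i}) [0..<k]" for f :: "'a \<Rightarrow> nat"
  let ?L = "{xs. partition_on E (set xs) \<and> distinct xs \<and> length xs = k}"
  have "bij_betw fibres (surjections E {..<k}) ?L"
  proof (rule bij_betw_imageI)
    show "inj_on fibres (surjections E {..<k})"
    proof (rule inj_onI)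
      fix f g assume f: "f \<in> surjections E {..<k}" and g: "g \<in> surjections E {..<k}"
        and eq: "fibres f = fibres g"
      have "f x = g x" if "x \<in> E" for x
      proof -
        from f that have "f x < k" by (auto simp: surjections_def PiE_iff)
        then have fibre_eq: "{y\<in>E. f y = f x} = {y\<in>E. g y = f x}"
          using arg_cong[OF eq, of "\<lambda>xs. xs ! f x"] by (simp add: fibres_def)
        have "x \<in> {y\<in>E. f y = f x}" using that by simp
        then have "x \<in> {y\<in>E. g y = f x}" by (simp only: fibre_eq)
        then show ?thesis by simp
      qed
      then show "f = g"
        using f g by (auto simp: surjections_def intro: PiE_ext)
    qed
    show "fibres ` surjections E {..<k} = ?L"
    proof (intro equalityI subsetI)
      fix xs assume "xs \<in> fibres ` surjections E {..<k}"
      then obtain f where f: "f \<in> surjections E {..<k}" and xs: "xs = fibres f" by blast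
      have nonempty: "\<exists>x\<in>E. f x = i" if "i < k" for i
      proof -
        have "i \<in> f ` E" using f that by (simp add: surjections_def)
        then show ?thesis by blast
      qed
      have bound: "f x < k" if "x \<in> E" for x
        using f that by (auto simp: surjections_def)
      have "partition_on E (set xs)"
      proof (rule partition_onI)
        show "\<Union> (set xs) = E" using bound by (auto simp: xs fibres_def)
        show "\<And>p q. \<lbrakk>p \<in> set xs; q \<in> set xs; p \<noteq> q\<rbrakk> \<Longrightarrow> disjnt p q"
          by (auto simp: xs fibres_def disjnt_def)
        show "{} \<notin> set xs" using nonempty by (fastforce simp: xs fibres_def)
      qed
      moreover have "distinct xs"
        unfolding xs fibres_def distinct_map
        using nonempty by (auto simp: inj_on_def) blast
      ultimately show "xs \<in> ?L" by (simp add: xs fibres_def)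
    next
      fix xs assume "xs \<in> ?L"
      then have P: "partition_on E (set xs)" and d: "distinct xs" and l: "length xs = k"
        by auto
      define f where "f = (\<lambda>x\<in>E. SOME i. i < k \<and> x \<in> xs ! i)"
      have f: "f x < k \<and> x \<in> xs ! f x" if "x \<in> E" for x
      proof -
        from that P obtain B where "B \<in> set xs" "x \<in> B" by (auto simp: partition_on_def)
        then have "\<exists>i. i < k \<and> x \<in> xs ! i" using l by (metis in_set_conv_nth)
        from someI_ex[OF this] show ?thesis using that by (simp add: f_def)
      qed
      have sub: "xs ! i \<subseteq> E" if "i < k" for i
        using that P l by (auto simp: partition_on_def)
      have uniq: "f x = i" if "i < k" "x \<in> xs ! i" for x i
      proof (rule ccontr)
        assume "f x \<noteq> i"
        have fx: "f x < k" "x \<in> xs ! f x" using f sub that by auto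
        then have "xs ! f x \<noteq> xs ! i"
          using \<open>f x \<noteq> i\<close> that d l by (simp add: nth_eq_iff_index_eq)
        moreover have "xs ! f x \<in> set xs" "xs ! i \<in> set xs" using fx that l by auto
        ultimately have "xs ! f x \<inter> xs ! i = {}"
          using P by (auto simp: partition_on_def disjoint_def)
        then show False using fx that by blast
      qed
      have fibre: "{x\<in>E. f x = i} = xs ! i" if "i < k" for i
        using f uniq[OF that] sub[OF that] that by auto
      have "fibres f = xs"
        by (rule nth_equalityI) (use l fibre in \<open>auto simp: fibres_def\<close>)
      moreover have "f \<in> surjections E {..<k}"
      proof -
        have "f \<in> E \<rightarrow>\<^sub>E {..<k}" using f by (auto simp: f_def)
        moreover have "i \<in> f ` E" if "i < k" for i
        proof -
          have "xs ! i \<noteq> {}" using P l that by (metis nth_mem partition_onD3)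
          then show ?thesis using fibre[OF that] by auto
        qed
        ultimately show ?thesis by (auto simp: surjections_def)
      qed
      ultimately show "xs \<in> fibres ` surjections E {..<k}" by blast
    qed
  qed
  then show ?thesis by (simp add: bij_betw_same_card)
qed

lemma ordered_blocks_distinct_Min:
  assumes "ordered_blocks n Bs"
  shows "distinct (map Min Bs)" "sorted (map Min Bs)"
proof -
  have "sorted_wrt (<) (map Min Bs)"
    using assms by (simp add: ordered_blocks_def sorted_wrt_map)
  then show "distinct (map Min Bs)" "sorted (map Min Bs)"
    unfolding strict_sorted_iff by simp_all
qed

lemma ordered_blocks_distinct:
  assumes "ordered_blocks n Bs"
  shows "distinct Bs"
  using ordered_blocks_distinct_Min(1)[OF assms] by (simp add: distinct_map)

lemma finite_ordered_blocks: "finite {Bs. ordered_blocks n Bs}"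
proof (rule finite_subset)
  show "{Bs. ordered_blocks n Bs} \<subseteq> {xs. set xs \<subseteq> Pow {1..n} \<and> distinct xs}"
    by (auto simp: ordered_blocks_distinct) (auto simp: ordered_blocks_def partition_on_def)
  show "finite {xs. set xs \<subseteq> Pow {1..n} \<and> distinct xs}"
    by (rule finite_subset_distinct) simp
qed

lemma ordered_blocks_length_le:
  assumes "ordered_blocks n Bs"
  shows "length Bs \<le> n"
proof -
  have "Min B \<in> {1..n}" if "B \<in> set Bs" for B
  proof -
    have "B \<subseteq> {1..n}" "B \<noteq> {}"
      using assms that by (auto simp: ordered_blocks_def partition_on_def)
    moreover from this have "Min B \<in> B" using finite_subset by (intro Min_in) auto
    ultimately show ?thesis by blast
  qed
  then have "set (map Min Bs) \<subseteq> {1..n}" by auto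
  from card_mono[OF _ this] have "card (set (map Min Bs)) \<le> n" by simp
  then show ?thesis
    using distinct_card[OF ordered_blocks_distinct_Min(1)[OF assms]] by simp
qed

text \<open>The list of minima is determined as the increasing enumeration of a set, and each block is
  determined by its minimum.\<close>

lemma ordered_blocks_unique:
  assumes "ordered_blocks n Bs" "ordered_blocks n Cs" "set Bs = set Cs"
  shows "Bs = Cs"
proof -
  have "map Min Bs = map Min Cs"
    using assms by (intro sorted_distinct_set_unique) (auto dest: ordered_blocks_distinct_Min)
  moreover have "inj_on Min (set Bs \<union> set Cs)"
    using ordered_blocks_distinct_Min(1)[OF assms(1)] assms(3) by (simp add: distinct_map)
  ultimately show ?thesis by (simp add: inj_on_map_eq_map)
qed

lemma ordered_blocks_exists:
  assumes "partition_on {1..n} P"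
  obtains Bs where "ordered_blocks n Bs" "set Bs = P"
proof -
  have "P \<subseteq> Pow {1..n}" using assms by (auto simp: partition_on_def)
  then have "finite P" by (rule finite_subset) simp
  then obtain xs where xs: "set xs = P" "distinct xs" using finite_distinct_list by blast
  define Bs where "Bs = sort_key Min xs"
  have set: "set Bs = P" and "distinct Bs" and "sorted (map Min Bs)"
    using xs by (simp_all add: Bs_def)
  have Min_mem: "Min B \<in> B" if "B \<in> P" for B
  proof -
    have "finite B" using \<open>P \<subseteq> Pow {1..n}\<close> that by (meson Pow_iff finite_atLeastAtMost
          finite_subset subsetD)
    moreover have "B \<noteq> {}" using assms that by (auto simp: partition_on_def)
    ultimately show ?thesis by simp
  qed
  have "inj_on Min P"
  proof (rule inj_onI)
    fix A B assume "A \<in> P" "B \<in> P" "Min A = Min B"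
    then have "Min A \<in> A \<inter> B" using Min_mem[of A] Min_mem[of B] by simp
    then show "A = B"
      using assms \<open>A \<in> P\<close> \<open>B \<in> P\<close> by (auto simp: partition_on_def disjoint_def)
  qed
  then have "distinct (map Min Bs)" using set \<open>distinct Bs\<close> by (simp add: distinct_map)
  with \<open>sorted (map Min Bs)\<close> have "sorted_wrt (<) (map Min Bs)"
    by (simp add: strict_sorted_iff)
  then have "ordered_blocks n Bs"
    using assms set by (simp add: ordered_blocks_def sorted_wrt_map)
  then show thesis using set that by blast
qed

text \<open>Each list counted on the left has \<open>k!\<close> rearrangements. Together they are all lists of \<open>k\<close>
  distinct blocks that partition \<open>[n]\<close>, each obtained once, and such lists correspond to surjections
  by their fibres.\<close>

lemma fact_times_card_ordered_blocks:
  "fact k * card {Bs. ordered_blocks n Bs \<and> length Bs = k} = card (surjections {1..n} {..<k})"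
proof -
  let ?O = "{Bs. ordered_blocks n Bs \<and> length Bs = k}"
  have "{xs. partition_on {1..n} (set xs) \<and> distinct xs \<and> length xs = k} =
      (\<Union>Bs\<in>?O. permutations_of_set (set Bs))"
  proof (intro equalityI subsetI)
    fix xs assume "xs \<in> {xs. partition_on {1..n} (set xs) \<and> distinct xs \<and> length xs = k}"
    then have xs: "partition_on {1..n} (set xs)" "distinct xs" "length xs = k" by auto
    obtain Bs where Bs: "ordered_blocks n Bs" "set Bs = set xs"
      using ordered_blocks_exists[OF xs(1)] .
    then have "length Bs = k"
      using xs ordered_blocks_distinct[OF Bs(1)] by (metis distinct_card)
    then show "xs \<in> (\<Union>Bs\<in>?O. permutations_of_set (set Bs))"
      using Bs xs by (auto simp: permutations_of_set_def)
  next
    fix xs assume "xs \<in> (\<Union>Bs\<in>?O. permutations_of_set (set Bs))"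
    then obtain Bs where Bs: "ordered_blocks n Bs" "length Bs = k" "set xs = set Bs" "distinct xs"
      by (auto simp: permutations_of_set_def)
    then have "length xs = k"
      using ordered_blocks_distinct[OF Bs(1)] by (metis distinct_card)
    then show "xs \<in> {xs. partition_on {1..n} (set xs) \<and> distinct xs \<and> length xs = k}"
      using Bs by (auto simp: ordered_blocks_def)
  qed
  moreover have "card (\<Union>Bs\<in>?O. permutations_of_set (set Bs)) =
      (\<Sum>Bs\<in>?O. card (permutations_of_set (set Bs)))"
  proof (rule card_UN_disjoint)
    show "finite ?O" by (rule finite_subset[OF _ finite_ordered_blocks]) auto
    show "\<forall>Bs\<in>?O. finite (permutations_of_set (set Bs))" by simp
    show "\<forall>Bs\<in>?O. \<forall>Cs\<in>?O. Bs \<noteq> Cs \<longrightarrow>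
        permutations_of_set (set Bs) \<inter> permutations_of_set (set Cs) = {}"
      using ordered_blocks_unique by (auto simp: permutations_of_set_def)
  qed
  moreover have "(\<Sum>Bs\<in>?O. card (permutations_of_set (set Bs))) = (\<Sum>Bs\<in>?O. fact k)"
    by (intro sum.cong refl) (auto simp: distinct_card ordered_blocks_distinct)
  ultimately show ?thesis using card_block_lists[of "{1..n}" k] by (simp add: mult.commute)
qed


section \<open>Deranged partitions\<close>

text \<open>Distinctness of the blocks turns the condition on blocks into a condition on positions,
  and it lets \<open>\<sigma>\<close> be recovered from the rearranged list.\<close>

lemma card_deranged_rearrangements:
  assumes "distinct xs"
  shows "card {permute_list \<sigma> xs | \<sigma>. \<sigma> permutes {..<length xs} \<and>
      (\<forall>i<length xs. xs ! \<sigma> i \<noteq> xs ! i)} = card (derangements {..<length xs})"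
proof -
  have mem: "\<sigma> i < length xs" if "\<sigma> permutes {..<length xs}" "i < length xs" for \<sigma> i
    using permutes_in_image[OF that(1), of i] that(2) by simp
  have "{permute_list \<sigma> xs | \<sigma>. \<sigma> permutes {..<length xs} \<and>
      (\<forall>i<length xs. xs ! \<sigma> i \<noteq> xs ! i)} =
      (\<lambda>\<sigma>. permute_list \<sigma> xs) ` derangements {..<length xs}"
    using assms mem by (auto simp: derangements_def nth_eq_iff_index_eq image_iff)
  moreover have "inj_on (\<lambda>\<sigma>. permute_list \<sigma> xs) (derangements {..<length xs})"
  proof (rule inj_onI, rule ext)
    fix \<sigma> \<tau> i
    assume "\<sigma> \<in> derangements {..<length xs}" "\<tau> \<in> derangements {..<length xs}"
      and eq: "permute_list \<sigma> xs = permute_list \<tau> xs"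
    then have p: "\<sigma> permutes {..<length xs}" "\<tau> permutes {..<length xs}"
      by (auto simp: derangements_def)
    show "\<sigma> i = \<tau> i"
    proof (cases "i < length xs")
      case True
      with eq p have "xs ! \<sigma> i = xs ! \<tau> i" by (metis permute_list_nth)
      then show ?thesis using assms mem p True by (simp add: nth_eq_iff_index_eq)
    next
      case False
      then show ?thesis using p by (simp add: permutes_not_in)
    qed
  qed
  ultimately show ?thesis by (simp add: card_image)
qed

lemma deranged_bell_eq_sum_ordered_blocks:
  "deranged_bell n =
    (\<Sum>k=0..n. card {Bs. ordered_blocks n Bs \<and> length Bs = k} * card (derangements {..<k}))"
proof -
  define R where "R Bs = {permute_list \<sigma> Bs | \<sigma>. \<sigma> permutes {..<length Bs} \<and>
      (\<forall>i<length Bs. Bs ! \<sigma> i \<noteq> Bs ! i)}" for Bs :: "nat set list"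
  let ?O = "{Bs. ordered_blocks n Bs}"
  have union: "deranged_partitions n = (\<Union>Bs\<in>?O. R Bs)"
    by (auto simp: deranged_partitions_def R_def)
  have set_R: "set xs = set Bs" if "xs \<in> R Bs" for xs Bs
    using that by (auto simp: R_def)
  have "deranged_bell n = (\<Sum>Bs\<in>?O. card (R Bs))"
    unfolding deranged_bell_def union
  proof (rule card_UN_disjoint[OF finite_ordered_blocks])
    show "\<forall>Bs\<in>?O. finite (R Bs)"
      using finite_deranged_partitions[of n] union by (auto intro: finite_subset)
    show "\<forall>Bs\<in>?O. \<forall>Cs\<in>?O. Bs \<noteq> Cs \<longrightarrow> R Bs \<inter> R Cs = {}"
      using ordered_blocks_unique set_R by (metis disjoint_iff mem_Collect_eq)
  qed
  also have "\<dots> = (\<Sum>Bs\<in>?O. card (derangements {..<length Bs}))"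
    unfolding R_def
    by (intro sum.cong refl) (simp add: card_deranged_rearrangements ordered_blocks_distinct)
  also have "\<dots> = (\<Sum>k=0..n. \<Sum>Bs\<in>{Bs \<in> ?O. length Bs = k}. card (derangements {..<length Bs}))"
    by (rule sum.group[symmetric])
      (auto simp: finite_ordered_blocks ordered_blocks_length_le)
  finally show ?thesis by simp
qed

theorem theorem3p2:
  fixes n :: nat
  shows "real (deranged_bell n) =
    (\<Sum>k=0..n. \<Sum>i=0..k. \<Sum>j=0..k.
       (-1) ^ (k + i - j) / fact i * real (k choose j) * real j ^ n)"
proof -
  have "real (card {Bs. ordered_blocks n Bs \<and> length Bs = k} * card (derangements {..<k})) =
      (\<Sum>i=0..k. \<Sum>j=0..k. (-1) ^ (k + i - j) / fact i * real (k choose j) * real j ^ n)" for k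
  proof -
    have "real (card {Bs. ordered_blocks n Bs \<and> length Bs = k} * card (derangements {..<k})) =
        real (fact k * card {Bs. ordered_blocks n Bs \<and> length Bs = k}) *
        (\<Sum>i=0..k. (-1) ^ i / fact i)"
      by (simp add: card_derangements)
    also have "\<dots> = (\<Sum>i=0..k. (-1) ^ i / fact i) *
        (\<Sum>j=0..k. (-1) ^ (k - j) * real (k choose j) * real j ^ n)"
      unfolding fact_times_card_ordered_blocks by (simp add: card_surjections)
    also have "\<dots> = (\<Sum>i=0..k. \<Sum>j=0..k. (-1) ^ i / fact i *
        ((-1) ^ (k - j) * real (k choose j) * real j ^ n))"
      by (rule sum_product)
    also have "\<dots> = (\<Sum>i=0..k. \<Sum>j=0..k.
        (-1) ^ (k + i - j) / fact i * real (k choose j) * real j ^ n)"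
    proof (intro sum.cong refl)
      fix i j assume "j \<in> {0..k}"
      then have "k + i - j = i + (k - j)" by simp
      then show "(-1) ^ i / fact i * ((-1) ^ (k - j) * real (k choose j) * real j ^ n) =
          (-1) ^ (k + i - j) / fact i * real (k choose j) * real j ^ n"
        by (simp only: power_add) simp
    qed
    finally show ?thesis .
  qed
  then show ?thesis by (simp add: deranged_bell_eq_sum_ordered_blocks)
qed

end
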